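(* For every constant $c$, the class of graphs $\{G:\pi(G)\leq c\}$ has bounded expansion.
   Context: All graphs are finite and simple. $|G|$ is the number of vertices and $\|G\|$ the number of edges of $G$. A colouring $f$ of the vertices of $G$ is repetitive on a path $(v_1,\dots,v_{2s})$ of $G$ ($s\geq 1$) if $f(v_i)=f(v_{i+s})$ for each $i\in\{1,\dots,s\}$. It is non-repetitive if it is not repetitive on any path of $G$ (in particular it is then a proper colouring). $\pi(G)$ is the minimum number of colours in a non-repetitive colouring of $G$. For $d\in\mathbb N$, a graph $H$ is a shallow minor of $G$ at depth $d$ if there is a subgraph $X$ of $G$ whose connected components each have radius at most $d$, such that $H$ is a simple graph obtained from $G$ by contracting each component of $X$ into a single vertex and then taking a subgraph. (The radius of a connected graph is the minimum over vertices $r$ of the maximum distance from $r$ to another vertex.) For a class $\mathcal C$, let $\nabla_d(\mathcal C)=\sup \|H\|/|H|$, the supremum over all (non-empty) shallow minors $H$ at depth $d$ of graphs in $\mathcal C$. The class $\mathcal C$ has bounded expansion if there is a function $f:\mathbb N\to\mathbb R$ with $\nabla_d(\mathcal C)\leq f(d)$ for all $d\in\mathbb N$. *)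

theory Defs
  imports
    "Graph_Theory.Digraph_Component"
    "Graph_Theory.Vertex_Walk"
    "Graph_Theory.Shortest_Path"
begin

text \<open>
  A finite simple graph is a \<^locale>\<open>pair_graph\<close>: a finite vertex set with a symmetric, loop-free
  arc relation, so each edge \<open>uv\<close> is the pair of arcs \<open>(u,v)\<close>, \<open>(v,u)\<close>.
  A class of graphs is a set of graphs over one vertex type; over any infinite type, such as
  \<^typ>\<open>nat\<close>, every finite graph occurs up to isomorphism.
\<close>

definition num_edges :: "'a pair_pre_digraph \<Rightarrow> nat" where
  "num_edges G = card ((\<lambda>(u, v). {u, v}) ` parcs G)"


subsection \<open>Non-repetitive colourings\<close>

definition repetitive_on :: "('a \<Rightarrow> 'c) \<Rightarrow> 'a list \<Rightarrow> bool" where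
  "repetitive_on f p \<longleftrightarrow> (\<exists>s\<ge>1. length p = 2 * s \<and> (\<forall>i<s. f (p ! i) = f (p ! (i + s))))"

definition nonrepetitive :: "'a pair_pre_digraph \<Rightarrow> ('a \<Rightarrow> 'c) \<Rightarrow> bool" where
  "nonrepetitive G f \<longleftrightarrow> (\<forall>p. vpath p (with_proj G) \<longrightarrow> \<not> repetitive_on f p)"

text \<open>Only finitely many colours occur on a finite graph, so natural numbers suffice as colours.\<close>

definition nonrep_number :: "'a pair_pre_digraph \<Rightarrow> nat" where
  "nonrep_number G = (LEAST k. \<exists>f :: 'a \<Rightarrow> nat. nonrepetitive G f \<and> card (f ` pverts G) = k)"


subsection \<open>Shallow minors and bounded expansion\<close>

text \<open>
  With unit weights, \<open>wf_digraph.\<mu>\<close> is the graph distance. Allowing \<open>v = r\<close> in the supremum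
  contributes distance 0, so a one-vertex graph has radius 0.
\<close>

definition radius :: "('a, 'b) pre_digraph \<Rightarrow> ereal" where
  "radius G = (INF r\<in>verts G. SUP v\<in>verts G. wf_digraph.\<mu> G (\<lambda>_. 1) r v)"

text \<open>
  For a symmetric digraph, the strongly connected components \<open>sccs\<close> are the connected components
  of the underlying graph.
\<close>

abbreviation components :: "'a pair_pre_digraph \<Rightarrow> ('a, 'a \<times> 'a) pre_digraph set" where
  "components X \<equiv> pre_digraph.sccs (with_proj X)"

text \<open>
  A vertex of the contracted graph is the set of vertices of \<open>G\<close> merged into it. Vertices of \<open>G\<close>
  outside \<open>X\<close> are unaffected by the contraction and appear as singletons.
\<close>

definition contract_components ::
    "'a pair_pre_digraph \<Rightarrow> 'a pair_pre_digraph \<Rightarrow> 'a set pair_pre_digraph" where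
  "contract_components G X =
     (let P = verts ` components X \<union> (\<lambda>v. {v}) ` (pverts G - pverts X) in
      \<lparr> pverts = P,
        parcs = {(A, B). A \<in> P \<and> B \<in> P \<and> A \<noteq> B \<and> (\<exists>u\<in>A. \<exists>v\<in>B. (u, v) \<in> parcs G)} \<rparr>)"

definition shallow_minor ::
    "nat \<Rightarrow> 'a set pair_pre_digraph \<Rightarrow> 'a pair_pre_digraph \<Rightarrow> bool" where
  "shallow_minor d H G \<longleftrightarrow>
     (\<exists>X. pair_graph X \<and> subgraph (with_proj X) (with_proj G) \<and>
          (\<forall>C\<in>components X. radius C \<le> ereal (real d)) \<and>
          pair_graph H \<and> subgraph (with_proj H) (with_proj (contract_components G X)))"

text \<open>In \<^typ>\<open>ereal\<close> the supremum always exists, possibly as \<open>\<infinity>\<close>.\<close>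

definition nabla :: "nat \<Rightarrow> 'a pair_pre_digraph set \<Rightarrow> ereal" where
  "nabla d \<C> = (SUP H \<in> {H. pverts H \<noteq> {} \<and> (\<exists>G\<in>\<C>. shallow_minor d H G)}.
                  ereal (real (num_edges H) / real (card (pverts H))))"

definition bounded_expansion :: "'a pair_pre_digraph set \<Rightarrow> bool" where
  "bounded_expansion \<C> \<longleftrightarrow> (\<exists>f :: nat \<Rightarrow> real. \<forall>d. nabla d \<C> \<le> ereal (f d))"

end

theory Submission
  imports Defs
begin

text \<open>
  Let \<open>G\<close> be non-repetitively coloured with at most \<open>C\<close> colours and let \<open>H\<close> be a shallow minor of
  \<open>G\<close> at depth \<open>d\<close>. The vertices of \<open>H\<close> are disjoint sets of vertices of \<open>G\<close>, here called blocks,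
  and each of them carries a breadth-first tree of depth at most \<open>d\<close>. An edge of \<open>H\<close> is realised by
  an arc of \<open>G\<close> between two blocks; together with the two tree branches from its ends to the roots
  this arc gives a path of length at most \<open>2 * d + 1\<close> between two roots. The number of edges of \<open>H\<close>
  is bounded by a constant, depending on \<open>C\<close> and \<open>d\<close>, times the number of vertices, as follows.

  \<^item> Keep only the edges that run from one side of a large cut of \<open>H\<close> to the other (\<open>max_cut\<close>), so
    that left trees and right trees never meet; then keep only those whose path has the most
    frequent sequence of colours (\<open>pigeonhole_fibre\<close>). Both steps lose a constant factor.

  \<^item> The paths still overlap, since many of them may share an initial part of a branch. But if the
    edges are many compared with the roots, then on the way from the roots to the edges, which
    count as the last level, the number of tree vertices in use must jump by a large factor between
    two consecutive levels \<open>a\<close> and \<open>a + 1\<close>. Keeping one edge for each vertex in use on level \<open>a + 1\<close> makes the paths disjoint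
    below level \<open>a\<close> and leaves many more edges than vertices on level \<open>a\<close>
    (\<open>branching_level\<close>). This is done on the left and then on the right.

  \<^item> What remains is a subdivision in \<open>G\<close> of a bipartite graph with more edges than vertices, all
    of whose subdivided edges \<open>p \<dots> q\<close> are coloured alike, say by the word \<open>\<alpha> m \<beta>\<close>. Such a graph has
    a walk \<open>p1 q1 p2 q2 p3\<close> of four distinct edges (\<open>four_edge_walk\<close>). Without its last vertex,
    it is subdivided to a path of \<open>G\<close> coloured \<open>\<alpha> m \<beta> m' \<alpha> m \<beta> m'\<close>, where \<open>m'\<close> is the reverse of
    \<open>m\<close>. This path is repetitive, a contradiction (\<open>linking_paths_bound\<close>).
\<close>

section \<open>Counting\<close>

lemma pigeonhole_fibre:
  assumes "finite M" "key ` M \<subseteq> K" "finite K" "card K \<le> W"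
  obtains w where "card M \<le> W * card {e \<in> M. key e = w}"
proof (rule ccontr)
  assume "\<not> thesis"
  with that have small: "W * card {e \<in> M. key e = w} < card M" for w
    by (meson not_le)
  have "card M = (\<Sum>w\<in>K. card {e \<in> M. key e = w})"
    using sum.group [OF assms(1,3,2), of "\<lambda>_. 1 :: nat"] by simp
  then have "W * card M = (\<Sum>w\<in>K. W * card {e \<in> M. key e = w})"
    by (simp add: sum_distrib_left)
  also have "\<dots> \<le> (\<Sum>w\<in>K. card M - 1)"
  proof (rule sum_mono)
    show "W * card {e \<in> M. key e = w} \<le> card M - 1" for w
      using small [of w] by linarith
  qed
  also have "\<dots> \<le> W * (card M - 1)"
    using assms(4) by simp
  finally show False
    using small [of undefined] assms
    by (cases "W = 0") (auto simp: card_gt_0_iff)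
qed

text \<open>
  Vertices are added one at a time, each on the side on which it cuts at least half of the arcs
  between it and its predecessors.
\<close>

lemma max_cut:
  assumes "finite V" "finite E" "E \<subseteq> V \<times> V" "\<And>a. (a, a) \<notin> E"
  shows "\<exists>S. card E \<le> 2 * card {e \<in> E. (fst e \<in> S) \<noteq> (snd e \<in> S)}"
  using assms
proof (induction V arbitrary: E rule: finite_induct)
  case empty
  then show ?case by simp
next
  case (insert v V)
  define E0 where "E0 = {e \<in> E. fst e \<noteq> v \<and> snd e \<noteq> v}"
  define F where "F = E - E0"
  have "E0 \<subseteq> V \<times> V"
    using insert.prems by (auto simp: E0_def)
  then obtain S where S: "card E0 \<le> 2 * card {e \<in> E0. (fst e \<in> S) \<noteq> (snd e \<in> S)}"
    using insert.IH [of E0] insert.prems by (auto simp: E0_def)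
  let ?cut = "\<lambda>S E. {e \<in> E. (fst e \<in> S) \<noteq> (snd e \<in> S)}"
  let ?S1 = "S - {v}" and ?S2 = "insert v S"
  have E: "E = E0 \<union> F" "E0 \<inter> F = {}" and fin: "finite E0" "finite F"
    using insert.prems by (auto simp: E0_def F_def)
  have F: "fst e = v \<and> snd e \<noteq> v \<or> fst e \<noteq> v \<and> snd e = v" if "e \<in> F" for e
    using that insert.prems by (cases e) (auto simp: F_def E0_def)
  have "F = ?cut ?S1 F \<union> ?cut ?S2 F"
    using F by auto
  then have "card F \<le> card (?cut ?S1 F) + card (?cut ?S2 F)"
    by (metis (lifting) card_Un_le)
  then have "card F \<le> 2 * card (?cut ?S1 F) \<or> card F \<le> 2 * card (?cut ?S2 F)"
    by linarith
  then obtain S' where S': "S' = ?S1 \<or> S' = ?S2" "card F \<le> 2 * card (?cut S' F)"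
    by blast
  have "?cut S' E0 = ?cut S E0"
    using S'(1) by (auto simp: E0_def)
  moreover have "?cut S' E = ?cut S' E0 \<union> ?cut S' F"
    using E(1) by auto
  then have "card (?cut S' E) = card (?cut S' E0) + card (?cut S' F)"
    using E(2) fin by (simp only:) (rule card_Un_disjoint, auto)
  moreover have "card E = card E0 + card F"
    using E fin by (simp add: card_Un_disjoint)
  ultimately show ?case
    using S S' by (intro exI [of _ S']) simp
qed

text \<open>
  Read \<open>M\<close> as a set of edges with one end on level \<open>i\<close> of a forest, and \<open>L k e\<close> as the ancestor of
  this end of \<open>e\<close> on level \<open>k\<close>. The edges
  themselves act as one further level \<open>Suc i\<close>: at \<open>a = i\<close> nothing is demanded of the selection, as
  different edges leave their common end separately. The level \<open>Suc a\<close> is the first one whose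
  population exceeds \<open>K ^ Suc a * n\<close>.
\<close>

lemma branching_level:
  fixes L :: "nat \<Rightarrow> 'e \<Rightarrow> 'v"
  assumes "finite M" "card (L 0 ` M) \<le> n" "K ^ Suc i * n < card M"
  obtains a M' where "a \<le> i" "M' \<subseteq> M" "card (L a ` M') \<le> K ^ a * n" "K ^ Suc a * n < card M'"
    "a < i \<longrightarrow> inj_on (L (Suc a)) M'"
proof (cases "\<forall>k\<le>i. card (L k ` M) \<le> K ^ k * n")
  case True
  then show ?thesis
    using assms by (intro that [of i M]) auto
next
  case False
  define b where "b = (LEAST k. k \<le> i \<and> \<not> card (L k ` M) \<le> K ^ k * n)"
  have b: "b \<le> i" "\<not> card (L b ` M) \<le> K ^ b * n"
    using False LeastI_ex [of "\<lambda>k. k \<le> i \<and> \<not> card (L k ` M) \<le> K ^ k * n"]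
    by (auto simp: b_def)
  have below: "card (L k ` M) \<le> K ^ k * n" if "k < b" for k
    using not_less_Least [OF that [unfolded b_def]] that b(1) by auto
  obtain a where a: "b = Suc a"
    using b assms(2) by (cases b) auto
  obtain M' where M': "M' \<subseteq> M" "inj_on (L b) M'" "L b ` M = L b ` M'"
    using subset_image_inj [of "L b ` M" "L b" M] by auto
  have "card (L a ` M') \<le> card (L a ` M)"
    using M' assms(1) by (intro card_mono) auto
  with below [of a] a have "card (L a ` M') \<le> K ^ a * n"
    by simp
  moreover have "K ^ Suc a * n < card M'"
    using b(2) M' a by (simp add: card_image)
  ultimately show ?thesis
    using that [of a M'] M' a b(1) by auto
qed

text \<open>
  In the bipartite graph with edges \<open>E\<close>, set aside one edge \<open>Q\<close> at each right vertex and then one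
  remaining edge \<open>P\<close> at each left vertex. Some edge \<open>e2\<close> is left over. It can be continued at its
  left end by an edge of \<open>P\<close>, and at the right ends, since neither \<open>e2\<close> nor that edge is in \<open>Q\<close>, by
  edges of \<open>Q\<close>. The outer vertices \<open>p e1\<close> and \<open>p e4\<close> may coincide.
\<close>

lemma four_edge_walk:
  assumes "finite E" "inj_on (\<lambda>e. (p e, q e)) E" "card (p ` E) + card (q ` E) < card E"
  obtains e1 e2 e3 e4 where "{e1, e2, e3, e4} \<subseteq> E"
    "q e1 = q e2" "p e2 = p e3" "q e3 = q e4" "p e1 \<noteq> p e2" "q e2 \<noteq> q e3" "p e3 \<noteq> p e4"
proof -
  obtain Q where Q: "Q \<subseteq> E" "inj_on q Q" "q ` E = q ` Q"
    using subset_image_inj [of "q ` E" q E] by auto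
  obtain P where P: "P \<subseteq> E - Q" "inj_on p P" "p ` (E - Q) = p ` P"
    using subset_image_inj [of "p ` (E - Q)" p "E - Q"] by auto
  have fin: "finite Q" "finite P"
    using Q P assms(1) by (auto intro: finite_subset)
  have "card P \<le> card (p ` E)"
    using P assms(1) card_mono [of "p ` E" "p ` P"] by (auto simp: card_image)
  moreover have "card Q = card (q ` E)"
    using Q by (simp add: card_image)
  moreover have "card (Q \<union> P) \<le> card Q + card P"
    by (rule card_Un_le)
  ultimately have "card (Q \<union> P) < card E"
    using assms(3) by linarith
  then obtain e2 where e2: "e2 \<in> E" "e2 \<notin> Q" "e2 \<notin> P"
    using card_mono [of "Q \<union> P" E] fin by fastforce
  have "p e2 \<in> p ` P"
    unfolding P(3) [symmetric] using e2 by blast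
  then obtain e3 where e3: "e3 \<in> P" "p e3 = p e2"
    by auto
  have "q e2 \<in> q ` Q" "q e3 \<in> q ` Q"
    unfolding Q(3) [symmetric] using e2(1) e3(1) P(1) by auto
  then obtain e1 e4 where e1: "e1 \<in> Q" "q e1 = q e2" and e4: "e4 \<in> Q" "q e4 = q e3"
    by (auto simp: image_iff)
  have inj: "p e \<noteq> p e' \<or> q e \<noteq> q e'" if "e \<in> E" "e' \<in> E" "e \<noteq> e'" for e e'
    using assms(2) that by (auto simp: inj_on_def)
  have E: "{e1, e2, e3, e4} \<subseteq> E"
    using e1 e2 e3 e4 P Q by auto
  show ?thesis
  proof (rule that [OF E])
    show "p e1 \<noteq> p e2" using inj [of e1 e2] e1 e2 E by auto
    show "q e2 \<noteq> q e3" using inj [of e2 e3] e3 e2 E by auto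
    show "p e3 \<noteq> p e4" using inj [of e3 e4] e3 e4 E P by auto
  qed (use e1 e3 e4 in auto)
qed

section \<open>Repetitions on linking paths\<close>

lemma vwalk_arcs_subset_iff:
  "set (vwalk_arcs p) \<subseteq> R \<longleftrightarrow> successively (\<lambda>u v. (u, v) \<in> R) p"
  by (induction p rule: vwalk_arcs.induct) auto

lemma nonrepetitiveD:
  assumes "nonrepetitive G f" "set (xs @ ys) \<subseteq> pverts G"
    "successively (\<lambda>u v. (u, v) \<in> parcs G) (xs @ ys)" "distinct (xs @ ys)" "xs \<noteq> []"
  shows "map f xs \<noteq> map f ys"
proof
  assume eq: "map f xs = map f ys"
  then have len: "length ys = length xs"
    by (metis length_map)
  have "f ((xs @ ys) ! i) = f ((xs @ ys) ! (i + length xs))" if "i < length xs" for i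
    using eq len that by (metis add.commute nth_append nth_append_length_plus nth_map)
  then have "repetitive_on f (xs @ ys)"
    using len assms(5) unfolding repetitive_on_def
    by (intro exI [of _ "length xs"]) (auto simp: Suc_le_eq)
  moreover have "vpath (xs @ ys) (with_proj G)"
    using assms by (auto simp: vpath_def vwalk_def vwalk_arcs_subset_iff)
  ultimately show False
    using assms(1) by (auto simp: nonrepetitive_def)
qed

text \<open>
  The path \<open>p e # link e @ [q e]\<close> subdivides the edge \<open>e\<close> of a bipartite graph. Dropping the last
  vertex of the four-edge walk both gives the two halves equal length and allows the walk to be a
  closed one.
\<close>

lemma linking_paths_bound:
  fixes link :: "'e \<Rightarrow> 'a list"
  assumes G: "pair_graph G" and f: "nonrepetitive G f" and fin: "finite E"
    and walk: "\<And>e. e \<in> E \<Longrightarrow> successively (\<lambda>u v. (u, v) \<in> parcs G) (p e # link e @ [q e])"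
    and verts: "\<And>e. e \<in> E \<Longrightarrow> set (p e # link e @ [q e]) \<subseteq> pverts G"
    and dist: "\<And>e. e \<in> E \<Longrightarrow> distinct (link e)"
    and disj: "\<And>e e'. e \<in> E \<Longrightarrow> e' \<in> E \<Longrightarrow> e \<noteq> e' \<Longrightarrow> set (link e) \<inter> set (link e') = {}"
    and ends: "\<And>e e'. e \<in> E \<Longrightarrow> e' \<in> E \<Longrightarrow> p e \<notin> set (link e') \<and> q e \<notin> set (link e') \<and> p e \<noteq> q e'"
    and inj: "inj_on (\<lambda>e. (p e, q e)) E"
    and col: "\<And>e e'. e \<in> E \<Longrightarrow> e' \<in> E \<Longrightarrow>
      map f (p e # link e @ [q e]) = map f (p e' # link e' @ [q e'])"
  shows "card E \<le> card (p ` E) + card (q ` E)"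
proof (rule ccontr)
  assume "\<not> ?thesis"
  then obtain e1 e2 e3 e4 where E: "{e1, e2, e3, e4} \<subseteq> E"
    and pq: "q e1 = q e2" "p e2 = p e3" "q e3 = q e4" "p e1 \<noteq> p e2" "q e2 \<noteq> q e3" "p e3 \<noteq> p e4"
    using four_edge_walk [OF fin inj] by (metis not_le)
  let ?xs = "p e1 # link e1 @ q e1 # rev (link e2)"
  let ?ys = "p e2 # link e3 @ q e3 # rev (link e4)"
  have sym: "(v, u) \<in> parcs G \<longleftrightarrow> (u, v) \<in> parcs G" for u v
    using G pair_sym_digraph.pair_sym_arcs [of G]
    by (auto simp: pair_graph_def pair_pseudo_graph_def symmetric_def sym_def)
  have half: "successively (\<lambda>u v. (u, v) \<in> parcs G) (p e # link e @ q e # rev (link e') @ [p e'])"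
    if "e \<in> E" "e' \<in> E" "q e = q e'" for e e'
  proof -
    have "successively (\<lambda>u v. (u, v) \<in> parcs G) (rev (p e' # link e' @ [q e']))"
      using walk [OF that(2)] by (subst successively_rev) (simp add: sym)
    then have "successively (\<lambda>u v. (u, v) \<in> parcs G) (q e # rev (link e') @ [p e'])"
      using that(3) by simp
    moreover have "successively (\<lambda>u v. (u, v) \<in> parcs G) ((p e # link e) @ [q e])"
      using walk [OF that(1)] by simp
    ultimately show ?thesis
      using successively_append_iff [of _ "p e # link e" "q e # rev (link e') @ [p e']"]
        successively_append_iff [of _ "p e # link e" "[q e]"] by simp
  qed
  have "successively (\<lambda>u v. (u, v) \<in> parcs G) (?xs @ [p e2])"
    using half [of e1 e2] E pq by simp
  moreover have "successively (\<lambda>u v. (u, v) \<in> parcs G) (?ys @ [p e4])"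
    using half [of e3 e4] E pq by simp
  then have "successively (\<lambda>u v. (u, v) \<in> parcs G) ?ys"
    unfolding successively_append_iff [of _ ?ys "[p e4]"] by blast
  ultimately have "successively (\<lambda>u v. (u, v) \<in> parcs G) (?xs @ ?ys)"
    unfolding successively_append_iff [of _ ?xs] by simp
  moreover have "set (?xs @ ?ys) \<subseteq> pverts G"
    using verts E by auto
  moreover have "distinct (?xs @ ?ys)"
  proof -
    have "e1 \<noteq> e2" "e1 \<noteq> e3" "e1 \<noteq> e4" "e2 \<noteq> e3" "e2 \<noteq> e4" "e3 \<noteq> e4"
      using pq by auto
    moreover have "e1 \<in> E" "e2 \<in> E" "e3 \<in> E" "e4 \<in> E"
      using E by auto
    moreover have "p e \<notin> set (link e')" "q e \<notin> set (link e')" "p e \<noteq> q e'" "q e' \<noteq> p e"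
      if "e \<in> E" "e' \<in> E" for e e'
      using ends [OF that] by auto
    ultimately show ?thesis
      using pq disj [of e1 e2] disj [of e1 e3] disj [of e1 e4] disj [of e2 e3] disj [of e2 e4]
        disj [of e3 e4] dist by (simp add: Int_commute Int_Un_distrib Int_Un_distrib2)
  qed
  moreover have "map f ?xs = map f ?ys"
  proof -
    have "map f (p e1 # link e1 @ [q e1]) = map f (p e3 # link e3 @ [q e3])"
      using col E by auto
    moreover have "map f (p e2 # link e2 @ [q e2]) = map f (p e4 # link e4 @ [q e4])"
      using col E by auto
    ultimately show ?thesis
      using pq by (simp add: rev_map [symmetric])
  qed
  ultimately show False
    using nonrepetitiveD [OF f, of ?xs ?ys] by simp
qed

section \<open>Rooted forests\<close>

text \<open>
  The roots are the vertices of depth 0, at which the value of \<open>par\<close> is arbitrary.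
\<close>

locale rooted_forest =
  fixes V :: "'a set" and T :: "'a rel" and par :: "'a \<Rightarrow> 'a" and dep :: "'a \<Rightarrow> nat"
  assumes parent: "v \<in> V \<Longrightarrow> 0 < dep v \<Longrightarrow> par v \<in> V \<and> (par v, v) \<in> T \<and> Suc (dep (par v)) = dep v"
begin

text \<open>The ancestor on level \<open>k\<close>, counted from the root; meaningful for \<open>k \<le> dep v\<close>.\<close>

definition anc :: "'a \<Rightarrow> nat \<Rightarrow> 'a" where
  "anc v k = (par ^^ (dep v - k)) v"

text \<open>The branch runs downwards from level \<open>k\<close> to \<open>v\<close> itself, and is empty if \<open>k\<close> lies below \<open>v\<close>.\<close>

definition branch :: "nat \<Rightarrow> 'a \<Rightarrow> 'a list" where
  "branch k v = map (anc v) [k..<Suc (dep v)]"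

lemma anc_self [simp]: "anc v (dep v) = v"
  by (simp add: anc_def)

lemma anc_level:
  assumes "v \<in> V" "k \<le> dep v"
  shows "anc v k \<in> V" "dep (anc v k) = k"
proof -
  have "(par ^^ m) v \<in> V \<and> dep ((par ^^ m) v) = dep v - m" if "m \<le> dep v" for m
    using that
  proof (induction m)
    case 0
    then show ?case using assms by simp
  next
    case (Suc m)
    then show ?case
      using parent [of "(par ^^ m) v"] by auto
  qed
  from this [of "dep v - k"] show "anc v k \<in> V" "dep (anc v k) = k"
    using assms by (auto simp: anc_def)
qed

lemma anc_anc:
  assumes "v \<in> V" "j \<le> k" "k \<le> dep v"
  shows "anc (anc v k) j = anc v j"
proof -
  have "dep v - j = (k - j) + (dep v - k)"
    using assms by simp
  then show ?thesis
    using anc_level [OF assms(1,3)] by (simp add: anc_def funpow_add)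
qed

lemma anc_arc:
  assumes "v \<in> V" "k < dep v"
  shows "(anc v k, anc v (Suc k)) \<in> T"
proof -
  have "dep v - k = Suc (dep v - Suc k)"
    using assms by simp
  then have "anc v k = par (anc v (Suc k))"
    by (simp add: anc_def)
  then show ?thesis
    using anc_level [of v "Suc k"] parent [of "anc v (Suc k)"] assms by simp
qed

lemma set_branch:
  assumes "v \<in> V" "z \<in> set (branch k v)"
  shows "z \<in> V" "k \<le> dep z" "dep z \<le> dep v" "z = anc v (dep z)"
  using assms anc_level by (auto simp: branch_def)

lemma distinct_branch: "v \<in> V \<Longrightarrow> distinct (branch k v)"
  unfolding branch_def distinct_map
  by (auto intro!: inj_on_inverseI [of _ dep] simp: anc_level(2) simp del: upt_Suc)

lemma branch_Cons: "k \<le> dep v \<Longrightarrow> branch k v = anc v k # branch (Suc k) v"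
  by (simp add: branch_def upt_conv_Cons del: upt_Suc)

lemma last_branch: "k \<le> dep v \<Longrightarrow> last (branch k v) = v"
  by (simp add: branch_def)

lemma root_reaches:
  assumes "v \<in> V" "k \<le> dep v"
  shows "(anc v 0, anc v k) \<in> T\<^sup>*"
  using assms(2)
proof (induction k)
  case (Suc k)
  then show ?case
    using anc_arc [OF assms(1), of k] by (simp add: rtrancl_into_rtrancl)
qed simp

lemma successively_branch:
  assumes "v \<in> V"
  shows "successively (\<lambda>u w. (u, w) \<in> T) (branch k v)"
  using assms by (auto simp: branch_def successively_conv_nth anc_arc nth_append simp del: upt_Suc)

text \<open>
  An arc \<open>e\<close> between two trees joins the ancestor of its tail on level \<open>a\<close> to the ancestor of its
  head on level \<open>b\<close> by a path, of which \<open>link a b e\<close> lists the inner vertices.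
\<close>

definition link :: "nat \<Rightarrow> nat \<Rightarrow> 'a \<times> 'a \<Rightarrow> 'a list" where
  "link a b e = branch (Suc a) (fst e) @ rev (branch (Suc b) (snd e))"

lemma link_ends:
  assumes "a \<le> dep (fst e)" "b \<le> dep (snd e)"
  shows "anc (fst e) a # link a b e @ [anc (snd e) b] = branch a (fst e) @ rev (branch b (snd e))"
  using assms by (simp add: link_def branch_Cons)

lemma successively_link:
  assumes "sym R" "T \<subseteq> R" "e \<in> R" "e \<in> V \<times> V" "a \<le> dep (fst e)" "b \<le> dep (snd e)"
  shows "successively (\<lambda>u v. (u, v) \<in> R) (anc (fst e) a # link a b e @ [anc (snd e) b])"
proof -
  have *: "successively (\<lambda>u w. (u, w) \<in> R) (branch k v)" if "v \<in> V" for k v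
    using successively_branch [OF that] by (rule successively_mono) (use assms(2) in auto)
  have "successively (\<lambda>u w. (w, u) \<in> R) (branch b (snd e))"
    using * [of "snd e" b] assms(4) symD [OF assms(1)]
    by (auto elim!: successively_mono simp: mem_Times_iff)
  moreover have "branch b (snd e) \<noteq> []" "branch a (fst e) \<noteq> []"
    using assms by (simp_all add: branch_Cons)
  ultimately show ?thesis
    using * [of "fst e" a] assms
    by (simp add: link_ends successively_append_iff successively_rev last_branch hd_rev mem_Times_iff)
qed

text \<open>
  The ratio required on the left is \<open>K = 2 ^ Suc d\<close>, because the selection on the right starts from
  the bound \<open>K ^ a * n\<close> on the left population and must be able to multiply it by 2 on each of up
  to \<open>Suc d\<close> levels. With ratio 2 on the right the final selection \<open>M2\<close> has more than twice as many
  edges as the bound \<open>2 ^ b * (K ^ a * n)\<close> on the number of ends on either side, which contradicts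
  \<open>linking_paths_bound\<close>.
\<close>

lemma links_of_one_type_bound:
  assumes G: "pair_graph G" and f: "nonrepetitive G f" and sub: "T \<subseteq> parcs G" "V \<subseteq> pverts G"
    and M: "finite M" "M \<subseteq> parcs G" "M \<subseteq> V \<times> V"
    and dep: "\<And>e. e \<in> M \<Longrightarrow> dep (fst e) = i" "\<And>e. e \<in> M \<Longrightarrow> dep (snd e) = j" "i \<le> d" "j \<le> d"
    and col: "\<And>e e'. e \<in> M \<Longrightarrow> e' \<in> M \<Longrightarrow>
        map f (branch 0 (fst e)) = map f (branch 0 (fst e'))
      \<and> map f (branch 0 (snd e)) = map f (branch 0 (snd e'))"
    and sides: "\<And>e e'. e \<in> M \<Longrightarrow> e' \<in> M \<Longrightarrow> anc (fst e) 0 \<noteq> anc (snd e') 0"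
    and inj: "inj_on (\<lambda>e. (anc (fst e) 0, anc (snd e) 0)) M"
    and roots: "card ((\<lambda>e. anc (fst e) 0) ` M) \<le> n" "card ((\<lambda>e. anc (snd e) 0) ` M) \<le> n"
  shows "card M \<le> 2 ^ (Suc d * Suc d) * n"
proof (rule ccontr)
  assume large: "\<not> ?thesis"
  define K :: nat where "K = 2 ^ Suc d"
  have K: "1 \<le> K"
    by (simp add: K_def)
  have "K ^ Suc i \<le> K ^ Suc d"
    using dep(3) K by (intro power_increasing) auto
  then have "K ^ Suc i * n \<le> 2 ^ (Suc d * Suc d) * n"
    by (simp add: K_def power_mult del: power_Suc mult_Suc mult_Suc_right)
  with large have "K ^ Suc i * n < card M"
    by linarith
  then obtain a M1 where a: "a \<le> i" and M1: "M1 \<subseteq> M"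
    and left: "card ((\<lambda>e. anc (fst e) a) ` M1) \<le> K ^ a * n" and large1: "K ^ Suc a * n < card M1"
    and inj1: "a < i \<longrightarrow> inj_on (\<lambda>e. anc (fst e) (Suc a)) M1"
    by (rule branching_level [where L = "\<lambda>k e. anc (fst e) k", OF M(1) roots(1)])
  have fin1: "finite M1"
    using M1 M(1) finite_subset by blast
  have "card ((\<lambda>e. anc (snd e) 0) ` M1) \<le> card ((\<lambda>e. anc (snd e) 0) ` M)"
    using M1 M(1) by (intro card_mono) auto
  also have "\<dots> \<le> n" by fact
  also have "n \<le> K ^ a * n"
    using K by simp
  finally have right0: "card ((\<lambda>e. anc (snd e) 0) ` M1) \<le> K ^ a * n" .
  have "(2::nat) ^ Suc j \<le> K"
    unfolding K_def using dep(4) by (intro power_increasing) auto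
  then have "2 ^ Suc j * (K ^ a * n) \<le> K * (K ^ a * n)"
    by (rule mult_right_mono) simp
  also have "\<dots> < card M1"
    using large1 by (simp add: mult.assoc)
  finally obtain b M2 where b: "b \<le> j" and M2: "M2 \<subseteq> M1"
    and right: "card ((\<lambda>e. anc (snd e) b) ` M2) \<le> 2 ^ b * (K ^ a * n)"
    and large2: "2 ^ Suc b * (K ^ a * n) < card M2"
    and inj2: "b < j \<longrightarrow> inj_on (\<lambda>e. anc (snd e) (Suc b)) M2"
    by (rule branching_level [where L = "\<lambda>k e. anc (snd e) k", OF fin1 right0])
  have fin2: "finite M2"
    using M2 fin1 finite_subset by blast
  have in_M: "e \<in> M" "fst e \<in> V" "snd e \<in> V" "e \<in> parcs G" "dep (fst e) = i" "dep (snd e) = j"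
    if "e \<in> M2" for e
  proof -
    show *: "e \<in> M"
      using that M2 M1 by blast
    show "fst e \<in> V" "snd e \<in> V" "e \<in> parcs G" "dep (fst e) = i" "dep (snd e) = j"
      using * M(2,3) dep(1,2) by (auto simp: mem_Times_iff)
  qed
  have sym: "sym (parcs G)"
    using G pair_sym_digraph.pair_sym_arcs [of G]
    by (auto simp: pair_graph_def pair_pseudo_graph_def symmetric_def)
  \<comment> \<open>Left and right branches have different roots, so they are disjoint.\<close>
  have root_fst: "anc z 0 = anc (fst e) 0" if "e \<in> M2" "z \<in> set (branch k (fst e))" for e z k
    using that in_M [of e] set_branch [of "fst e" z k] anc_anc [of "fst e" 0 "dep z"] by simp
  have root_snd: "anc z 0 = anc (snd e) 0" if "e \<in> M2" "z \<in> set (branch k (snd e))" for e z k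
    using that in_M [of e] set_branch [of "snd e" z k] anc_anc [of "snd e" 0 "dep z"] by simp
  have across: "z \<notin> set (branch k' (snd e'))"
    if "e \<in> M2" "e' \<in> M2" "z \<in> set (branch k (fst e))" for e e' z k k'
    using root_fst [OF that(1,3)] root_snd [OF that(2), of z k'] sides [of e e'] in_M that by auto
  \<comment> \<open>A common vertex of two branches below level \<open>a\<close> would have a single ancestor on level
    \<open>Suc a\<close>, but the selected arcs have different ones.\<close>
  have fst_disj: "set (branch (Suc a) (fst e)) \<inter> set (branch (Suc a) (fst e')) = {}"
    if "e \<in> M2" "e' \<in> M2" "e \<noteq> e'" for e e'
  proof (rule ccontr)
    assume "\<not> ?thesis"
    then obtain z where z: "z \<in> set (branch (Suc a) (fst e))" "z \<in> set (branch (Suc a) (fst e'))"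
      by blast
    have "anc (fst e) (Suc a) = anc (fst e') (Suc a)" "a < i"
      using set_branch [OF _ z(1)] set_branch [OF _ z(2)] in_M that
        anc_anc [of "fst e" "Suc a" "dep z"] anc_anc [of "fst e'" "Suc a" "dep z"] by auto
    then show False
      using inj1 that M2 by (auto simp: inj_on_def)
  qed
  have snd_disj: "set (branch (Suc b) (snd e)) \<inter> set (branch (Suc b) (snd e')) = {}"
    if "e \<in> M2" "e' \<in> M2" "e \<noteq> e'" for e e'
  proof (rule ccontr)
    assume "\<not> ?thesis"
    then obtain z where z: "z \<in> set (branch (Suc b) (snd e))" "z \<in> set (branch (Suc b) (snd e'))"
      by blast
    have "anc (snd e) (Suc b) = anc (snd e') (Suc b)" "b < j"
      using set_branch [OF _ z(1)] set_branch [OF _ z(2)] in_M that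
        anc_anc [of "snd e" "Suc b" "dep z"] anc_anc [of "snd e'" "Suc b" "dep z"] by auto
    then show False
      using inj2 that by (auto simp: inj_on_def)
  qed
  have anc_fst: "anc (fst e) a \<in> set (branch a (fst e))" "dep (anc (fst e) a) = a"
    and anc_snd: "anc (snd e) b \<in> set (branch b (snd e))" "dep (anc (snd e) b) = b"
    if "e \<in> M2" for e
    using in_M [OF that] a b anc_level by (auto simp: branch_Cons)
  have "card M2 \<le> card ((\<lambda>e. anc (fst e) a) ` M2) + card ((\<lambda>e. anc (snd e) b) ` M2)"
  proof (rule linking_paths_bound [OF G f fin2, where link = "link a b"])
    fix e assume e: "e \<in> M2"
    show "successively (\<lambda>u v. (u, v) \<in> parcs G) (anc (fst e) a # link a b e @ [anc (snd e) b])"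
      using in_M [OF e] a b by (intro successively_link sym sub) (auto simp: mem_Times_iff)
    have ends: "anc (fst e) a # link a b e @ [anc (snd e) b]
        = branch a (fst e) @ rev (branch b (snd e))"
      using in_M [OF e] a b by (intro link_ends) auto
    show "set (anc (fst e) a # link a b e @ [anc (snd e) b]) \<subseteq> pverts G"
      unfolding ends using set_branch(1) in_M [OF e] sub(2) by auto
    show "distinct (link a b e)"
      using distinct_branch in_M [OF e] across [OF e e] by (auto simp: link_def)
    fix e' assume e': "e' \<in> M2"
    have ends': "anc (fst e') a # link a b e' @ [anc (snd e') b]
        = branch a (fst e') @ rev (branch b (snd e'))"
      using in_M [OF e'] a b by (intro link_ends) auto
    show "set (link a b e) \<inter> set (link a b e') = {}" if "e \<noteq> e'"
      using fst_disj [OF e e' that] snd_disj [OF e e' that] across [OF e e'] across [OF e' e]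
      by (auto simp: link_def)
    show "anc (fst e) a \<notin> set (link a b e') \<and> anc (snd e) b \<notin> set (link a b e')
        \<and> anc (fst e) a \<noteq> anc (snd e') b"
      using anc_fst [OF e] anc_snd [OF e] anc_snd [OF e'] across [OF e e'] across [OF e' e]
        set_branch(2) [of "fst e'" "anc (fst e) a" "Suc a"]
        set_branch(2) [of "snd e'" "anc (snd e) b" "Suc b"] in_M [OF e']
      by (auto simp: link_def)
    have drop: "branch k v = drop k (branch 0 v)" for k v
      by (simp add: branch_def drop_map drop_upt del: upt_Suc)
    show "map f (anc (fst e) a # link a b e @ [anc (snd e) b])
        = map f (anc (fst e') a # link a b e' @ [anc (snd e') b])"
      unfolding ends ends' using col [of e e'] in_M(1) e e'
      by (simp add: drop [of a] drop [of b] drop_map [symmetric] rev_map [symmetric])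
  next
    show "inj_on (\<lambda>e. (anc (fst e) a, anc (snd e) b)) M2"
    proof (rule inj_onI)
      fix e e' assume e: "e \<in> M2" "e' \<in> M2"
        and eq: "(anc (fst e) a, anc (snd e) b) = (anc (fst e') a, anc (snd e') b)"
      have "anc (fst e) 0 = anc (fst e') 0" "anc (snd e) 0 = anc (snd e') 0"
        using anc_anc [of "fst e" 0 a] anc_anc [of "fst e'" 0 a] anc_anc [of "snd e" 0 b]
          anc_anc [of "snd e'" 0 b] in_M e eq a b by auto
      then show "e = e'"
        using inj in_M(1) e by (auto simp: inj_on_def)
    qed
  qed
  also have "card ((\<lambda>e. anc (fst e) a) ` M2) \<le> card ((\<lambda>e. anc (fst e) a) ` M1)"
    using M2 fin1 by (intro card_mono) auto
  also note left
  also have "K ^ a * n \<le> 2 ^ b * (K ^ a * n)"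
    by simp
  also note right
  finally show False
    using large2 by simp
qed

text \<open>
  The pair of colour words along the two branches is the type of an arc. It also determines the
  depths of both ends, being the lengths of the words minus one.
\<close>

lemma links_bound:
  assumes G: "pair_graph G" and f: "nonrepetitive G f" and sub: "T \<subseteq> parcs G" "V \<subseteq> pverts G"
    and M: "finite M" "M \<subseteq> parcs G" "M \<subseteq> V \<times> V"
    and dep: "\<And>v. v \<in> V \<Longrightarrow> dep v \<le> d"
    and colours: "card (f ` pverts G) \<le> C"
    and sides: "\<And>e e'. e \<in> M \<Longrightarrow> e' \<in> M \<Longrightarrow> anc (fst e) 0 \<noteq> anc (snd e') 0"
    and inj: "inj_on (\<lambda>e. (anc (fst e) 0, anc (snd e) 0)) M"
    and roots: "card ((\<lambda>e. anc (fst e) 0) ` M) \<le> n" "card ((\<lambda>e. anc (snd e) 0) ` M) \<le> n"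
  shows "card M \<le> (\<Sum>i\<le>Suc d. C ^ i)\<^sup>2 * (2 ^ (Suc d * Suc d) * n)"
proof -
  define words where "words = {w. set w \<subseteq> f ` pverts G \<and> length w \<le> Suc d}"
  define type where "type = (\<lambda>e. (map f (branch 0 (fst e)), map f (branch 0 (snd e))))"
  have fin: "finite (f ` pverts G)"
    using G pair_fin_digraph.pair_finite_verts [of G]
    by (auto simp: pair_graph_def pair_digraph_def)
  have "card words = (\<Sum>i\<le>Suc d. card (f ` pverts G) ^ i)"
    unfolding words_def by (rule card_lists_length_le [OF fin])
  also have "\<dots> \<le> (\<Sum>i\<le>Suc d. C ^ i)"
    using colours by (intro sum_mono power_mono) auto
  finally have le: "card words \<le> (\<Sum>i\<le>Suc d. C ^ i)" .
  have le2: "card (words \<times> words) \<le> (\<Sum>i\<le>Suc d. C ^ i)\<^sup>2"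
    unfolding power2_eq_square card_cartesian_product by (intro mult_le_mono le)
  have fin_words: "finite (words \<times> words)"
    unfolding words_def using finite_lists_length_le [OF fin] by (intro finite_cartesian_product)
  have word: "map f (branch 0 v) \<in> words" if "v \<in> V" for v
    using dep [OF that] set_branch(1) [OF that] sub(2) by (auto simp: words_def) (auto simp: branch_def)
  have "type ` M \<subseteq> words \<times> words"
    using M(3) word by (auto simp: type_def)
  from pigeonhole_fibre [OF M(1) this fin_words le2]
  obtain t where t: "card M \<le> (\<Sum>i\<le>Suc d. C ^ i)\<^sup>2 * card {e \<in> M. type e = t}" .
  let ?M = "{e \<in> M. type e = t}"
  have "card ?M \<le> 2 ^ (Suc d * Suc d) * n"
  proof (cases "?M = {}")
    case True
    then show ?thesis
      unfolding True by simp
  next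
    case False
    then obtain e0 where e0: "e0 \<in> M" "type e0 = t"
      by blast
    have len: "dep v = dep w" if "map f (branch 0 v) = map f (branch 0 w)" for v w
      using map_eq_imp_length_eq [OF that] by (simp add: branch_def)
    show ?thesis
    proof (rule links_of_one_type_bound [OF G f sub])
      show "finite ?M" "?M \<subseteq> parcs G" "?M \<subseteq> V \<times> V"
        using M by auto
      show "dep (fst e) = dep (fst e0)" "dep (snd e) = dep (snd e0)" if "e \<in> ?M" for e
        using that e0 len [of "fst e" "fst e0"] len [of "snd e" "snd e0"]
        by (auto simp: type_def)
      show "dep (fst e0) \<le> d" "dep (snd e0) \<le> d"
        using dep e0 M(3) by auto
      show "inj_on (\<lambda>e. (anc (fst e) 0, anc (snd e) 0)) ?M"
        using inj by (rule inj_on_subset) auto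
      have "card ((\<lambda>e. anc (fst e) 0) ` ?M) \<le> card ((\<lambda>e. anc (fst e) 0) ` M)"
        "card ((\<lambda>e. anc (snd e) 0) ` ?M) \<le> card ((\<lambda>e. anc (snd e) 0) ` M)"
        using M(1) by (intro card_mono; auto)+
      then show "card ((\<lambda>e. anc (fst e) 0) ` ?M) \<le> n" "card ((\<lambda>e. anc (snd e) 0) ` ?M) \<le> n"
        using roots by linarith+
      show "map f (branch 0 (fst e)) = map f (branch 0 (fst e'))
          \<and> map f (branch 0 (snd e)) = map f (branch 0 (snd e'))" if "e \<in> ?M" "e' \<in> ?M" for e e'
        using that by (auto simp: type_def)
      show "anc (fst e) 0 \<noteq> anc (snd e') 0" if "e \<in> ?M" "e' \<in> ?M" for e e'
        using that sides by simp
    qed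
  qed
  with t show ?thesis
    by (meson le_trans mult_le_mono2)
qed

end

section \<open>Shallow minors\<close>

text \<open>
  Breadth-first search from all centres at once: the depth is the distance to the nearest centre,
  which is the centre of the own block because no arc of \<open>T\<close> leaves a block.
\<close>

lemma block_forest:
  assumes disj: "\<And>A B. A \<in> P \<Longrightarrow> B \<in> P \<Longrightarrow> A \<noteq> B \<Longrightarrow> A \<inter> B = {}"
    and closed: "\<And>A u v. A \<in> P \<Longrightarrow> u \<in> A \<Longrightarrow> (u, v) \<in> T \<Longrightarrow> v \<in> A"
    and centre: "\<And>A. A \<in> P \<Longrightarrow> c A \<in> A"
    and reach: "\<And>A v. A \<in> P \<Longrightarrow> v \<in> A \<Longrightarrow> \<exists>m\<le>d. (c A, v) \<in> T ^^ m"
  obtains par dep where "rooted_forest (\<Union> P) T par dep" "\<forall>v\<in>\<Union> P. dep v \<le> d"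
    "\<forall>A\<in>P. \<forall>v\<in>A. rooted_forest.anc par dep v 0 = c A"
proof -
  define dep where "dep = (\<lambda>v. LEAST m. \<exists>A\<in>P. (c A, v) \<in> T ^^ m)"
  define par where "par = (\<lambda>v. SOME u. u \<in> \<Union> P \<and> (u, v) \<in> T \<and> Suc (dep u) = dep v)"
  have dep_le: "dep v \<le> m" if "A \<in> P" "(c A, v) \<in> T ^^ m" for A v m
    unfolding dep_def using that by (intro Least_le) blast
  have dep_ex: "\<exists>A\<in>P. (c A, v) \<in> T ^^ dep v" if "v \<in> \<Union> P" for v
    unfolding dep_def using that reach by (intro LeastI_ex [of "\<lambda>m. \<exists>A\<in>P. (c A, v) \<in> T ^^ m"]) blast
  have closed_star: "v \<in> A" if "(u, v) \<in> T\<^sup>*" "A \<in> P" "u \<in> A" for A u v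
    using that by (induction rule: rtrancl_induct) (auto intro: closed)
  have par: "par v \<in> \<Union> P \<and> (par v, v) \<in> T \<and> Suc (dep (par v)) = dep v"
    if v: "v \<in> \<Union> P" and pos: "0 < dep v" for v
  proof -
    obtain m where m: "dep v = Suc m"
      using pos by (cases "dep v") auto
    then obtain A u where A: "A \<in> P" and u: "(c A, u) \<in> T ^^ m" "(u, v) \<in> T"
      using dep_ex [OF v] by (auto elim: relpow_Suc_E)
    have uA: "u \<in> A"
      using closed_star [OF relpow_imp_rtrancl [OF u(1)] A] centre [OF A] .
    then obtain B where "B \<in> P" "(c B, u) \<in> T ^^ dep u"
      using dep_ex A by blast
    then have "dep v \<le> Suc (dep u)"
      using dep_le relpow_Suc_I u(2) by metis
    then have "Suc (dep u) = dep v"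
      using dep_le [OF A u(1)] m by simp
    then show ?thesis
      unfolding par_def by (rule_tac someI [of _ u]) (use uA A u in blast)
  qed
  interpret rooted_forest "\<Union> P" T par dep
    by unfold_locales (rule par)
  show thesis
  proof (rule that)
    show "rooted_forest (\<Union> P) T par dep" by unfold_locales
    show "\<forall>v\<in>\<Union> P. dep v \<le> d"
      using reach dep_le by (meson UnionE le_trans)
    show "\<forall>A\<in>P. \<forall>v\<in>A. anc v 0 = c A"
    proof (intro ballI)
      fix A v assume A: "A \<in> P" and v: "v \<in> A"
      have vP: "v \<in> \<Union> P"
        using A v by blast
      have "anc v 0 \<in> \<Union> P" "dep (anc v 0) = 0"
        using anc_level [OF vP, of 0] by auto
      then obtain B where B: "B \<in> P" "anc v 0 = c B"
        using dep_ex [of "anc v 0"] by auto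
      have "v \<in> B"
        using root_reaches [OF vP, of "dep v"] closed_star [of "anc v 0" v B] B centre by simp
      then show "anc v 0 = c A"
        using disj [OF A B(1)] v B(2) by blast
    qed
  qed
qed

lemma cas_imp_relpow:
  assumes "tail C = fst" "head C = snd" "set p \<subseteq> R" "pre_digraph.cas C u p v"
  shows "(u, v) \<in> R ^^ length p"
  using assms(3,4)
proof (induction p arbitrary: u)
  case (Cons e p)
  then have "(u, snd e) \<in> R" "(snd e, v) \<in> R ^^ length p"
    using assms(1,2) by (auto simp: pre_digraph.cas.simps)
  then show ?case
    using relpow_Suc_I2 by fastforce
qed (simp add: pre_digraph.cas.simps)

text \<open>
  The radius is an infimum of suprema of infima. As distances are integers, all of them are
  handled by comparison with \<open>d + 1\<close>: some vertex has all distances below \<open>d + 1\<close>, hence at most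
  \<open>d\<close>.
\<close>

lemma radius_centre:
  assumes "wf_digraph C" "tail C = fst" "head C = snd" "radius C \<le> ereal (real d)"
    "arcs C \<subseteq> R"
  shows "\<exists>r\<in>verts C. \<forall>v\<in>verts C. \<exists>m\<le>d. (r, v) \<in> R ^^ m"
proof -
  interpret wf_digraph C by fact
  have "radius C < ereal (real d + 1)"
    using assms(4) by (rule le_less_trans) simp
  then obtain r where r: "r \<in> verts C" "(SUP v\<in>verts C. \<mu> (\<lambda>_. 1) r v) < ereal (real d + 1)"
    unfolding radius_def INF_less_iff by blast
  have "\<exists>m\<le>d. (r, v) \<in> R ^^ m" if "v \<in> verts C" for v
  proof -
    have "\<mu> (\<lambda>_. 1) r v \<le> (SUP v\<in>verts C. \<mu> (\<lambda>_. 1) r v)"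
      using that by (rule SUP_upper)
    also note r(2)
    finally have "\<mu> (\<lambda>_. 1) r v < ereal (real d + 1)" .
    then obtain p where p: "awalk r p v" "awalk_cost (\<lambda>_. 1) p < real d + 1"
      unfolding \<mu>_def INF_less_iff by auto
    then have "length p \<le> d"
      by (simp add: awalk_cost_def sum_list_triv)
    then show ?thesis
      using p(1) cas_imp_relpow [OF assms(2,3), of p R r v] assms(5) by (auto simp: awalk_def)
  qed
  with r(1) show ?thesis by blast
qed

text \<open>
  What the counting needs to know about a shallow minor; \<open>T\<close> is the arc set of the contracted
  subgraph. A vertex outside that subgraph is a block of its own, with itself as centre.
\<close>

lemma shallow_minor_blocks:
  assumes G: "pair_graph G" and minor: "shallow_minor d H G"
  obtains T where "T \<subseteq> parcs G" "\<Union> (pverts H) \<subseteq> pverts G"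
    "\<forall>A\<in>pverts H. \<forall>B\<in>pverts H. A \<noteq> B \<longrightarrow> A \<inter> B = {}"
    "\<forall>A\<in>pverts H. T `` A \<subseteq> A"
    "\<forall>A\<in>pverts H. \<exists>r\<in>A. \<forall>v\<in>A. \<exists>m\<le>d. (r, v) \<in> T ^^ m"
    "\<forall>e\<in>parcs H. \<exists>u\<in>fst e. \<exists>v\<in>snd e. (u, v) \<in> parcs G"
proof -
  obtain X where X: "pair_graph X" and XG: "subgraph (with_proj X) (with_proj G)"
    and rad: "\<And>C. C \<in> components X \<Longrightarrow> radius C \<le> ereal (real d)"
    and H: "subgraph (with_proj H) (with_proj (contract_components G X))"
    using minor unfolding shallow_minor_def by blast
  interpret X: pair_graph X by fact
  let ?P = "verts ` components X \<union> (\<lambda>v. {v}) ` (pverts G - pverts X)"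
  have HP: "pverts H \<subseteq> ?P" and HE: "\<forall>e\<in>parcs H. \<exists>u\<in>fst e. \<exists>v\<in>snd e. (u, v) \<in> parcs G"
    using H by (auto simp: subgraph_def contract_components_def Let_def)
  have XV: "pverts X \<subseteq> pverts G" and XE: "parcs X \<subseteq> parcs G"
    using XG by (auto simp: subgraph_def)
  have comp: "A \<in> X.sccs_verts" "A \<subseteq> pverts X" if "A \<in> verts ` components X" for A
  proof -
    show "A \<in> X.sccs_verts"
      using that X.sccs_verts_conv by simp
    from that obtain C where C: "A = verts C" "C \<in> components X"
      by (rule imageE)
    have "subgraph C (with_proj X)"
      using X.in_sccs_imp_induced [OF C(2)] by (simp add: induced_subgraph_def)
    then show "A \<subseteq> pverts X"
      unfolding C(1) by (simp add: subgraph_def)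
  qed
  have block: "A \<in> verts ` components X \<or> (\<exists>v \<in> pverts G - pverts X. A = {v})" if "A \<in> pverts H" for A
    using subsetD [OF HP that] by (elim UnE imageE) auto
  show thesis
  proof (rule that [OF XE])
    have "A \<subseteq> pverts G" if "A \<in> pverts H" for A
      using block [OF that]
    proof
      assume "A \<in> verts ` components X"
      then show ?thesis
        using comp(2) XV by (meson subset_trans)
    qed auto
    then show "\<Union> (pverts H) \<subseteq> pverts G"
      by blast
    show "\<forall>A\<in>pverts H. \<forall>B\<in>pverts H. A \<noteq> B \<longrightarrow> A \<inter> B = {}"
    proof (intro ballI impI)
      fix A B assume A: "A \<in> pverts H" and B: "B \<in> pverts H" and "A \<noteq> B"
      then show "A \<inter> B = {}"
        using block [OF A] block [OF B] comp [of A] comp [of B] X.sccs_verts_disjoint [of A B]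
        by (elim disjE bexE) (simp_all add: disjoint_iff, blast+)
    qed
    have "v \<in> A" if A: "A \<in> pverts H" "u \<in> A" "(u, v) \<in> parcs X" for A u v
    proof -
      have "u \<in> pverts X"
        using A(3) X.in_arcsD1 by blast
      then have "A \<in> X.sccs_verts"
        using block [OF A(1)] A(2) comp(1) [of A] by auto
      moreover have "u \<rightarrow>\<^sup>*\<^bsub>with_proj X\<^esub> v" "v \<rightarrow>\<^sup>*\<^bsub>with_proj X\<^esub> u"
        using A(3) X.pair_sym_arcs by (auto simp: symmetric_def dest: symD)
      ultimately show ?thesis
        using A(2) unfolding X.in_sccs_verts_conv_reachable by blast
    qed
    then show "\<forall>A\<in>pverts H. parcs X `` A \<subseteq> A"
      by blast
    show "\<forall>A\<in>pverts H. \<exists>r\<in>A. \<forall>v\<in>A. \<exists>m\<le>d. (r, v) \<in> parcs X ^^ m"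
    proof
      fix A assume A: "A \<in> pverts H"
      show "\<exists>r\<in>A. \<forall>v\<in>A. \<exists>m\<le>d. (r, v) \<in> parcs X ^^ m"
      proof (cases "A \<in> verts ` components X")
        case True
        then obtain C where C: "A = verts C" "C \<in> components X"
          by (rule imageE)
        have sub: "subgraph C (with_proj X)"
          using X.in_sccs_imp_induced [OF C(2)] by (simp add: induced_subgraph_def)
        then show ?thesis
          unfolding C(1) using rad [OF C(2)]
          by (intro radius_centre) (auto simp: subgraph_def compatible_def)
      next
        case False
        then obtain v where "A = {v}"
          using block [OF A] by blast
        then show ?thesis
          by (auto intro!: exI [of _ 0])
      qed
    qed
  qed (rule HE)
qed

text \<open>
  The factor 4 pays for the cut (2) and for orienting its edges from \<open>S\<close> to the complement (2).
  Every arc of \<open>H\<close> in the oriented cut is represented by one arc of \<open>G\<close>, and the roots of the two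
  branches at the latter are the centres of the two blocks.
\<close>

lemma shallow_minor_num_edges_bound:
  assumes G: "pair_graph G" and f: "nonrepetitive G f" and colours: "card (f ` pverts G) \<le> C"
    and H: "pair_graph H" and minor: "shallow_minor d H G"
  shows "num_edges H \<le> 4 * ((\<Sum>i\<le>Suc d. C ^ i)\<^sup>2 * (2 ^ (Suc d * Suc d) * card (pverts H)))"
proof -
  interpret H: pair_graph H by fact
  obtain T where T: "T \<subseteq> parcs G" "\<Union> (pverts H) \<subseteq> pverts G"
    and disj: "\<forall>A\<in>pverts H. \<forall>B\<in>pverts H. A \<noteq> B \<longrightarrow> A \<inter> B = {}"
    and closed: "\<forall>A\<in>pverts H. T `` A \<subseteq> A"
    and centre: "\<forall>A\<in>pverts H. \<exists>r\<in>A. \<forall>v\<in>A. \<exists>m\<le>d. (r, v) \<in> T ^^ m"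
    and arc: "\<forall>e\<in>parcs H. \<exists>u\<in>fst e. \<exists>v\<in>snd e. (u, v) \<in> parcs G"
    by (rule shallow_minor_blocks [OF G minor])
  obtain c where c: "\<And>A. A \<in> pverts H \<Longrightarrow> c A \<in> A"
    "\<And>A v. A \<in> pverts H \<Longrightarrow> v \<in> A \<Longrightarrow> \<exists>m\<le>d. (c A, v) \<in> T ^^ m"
    using bchoice [OF centre [unfolded Bex_def]] by blast
  obtain par dep where forest: "rooted_forest (\<Union> (pverts H)) T par dep"
    and dep: "\<forall>v\<in>\<Union> (pverts H). dep v \<le> d"
    and root: "\<forall>A\<in>pverts H. \<forall>v\<in>A. rooted_forest.anc par dep v 0 = c A"
  proof (rule block_forest [of "pverts H" T c d])
    show "A \<inter> B = {}" if "A \<in> pverts H" "B \<in> pverts H" "A \<noteq> B" for A B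
      using disj that by simp
    show "v \<in> A" if "A \<in> pverts H" "u \<in> A" "(u, v) \<in> T" for A u v
      using closed that by blast
  qed (use c in simp_all)
  interpret rooted_forest "\<Union> (pverts H)" T par dep by fact
  have in_H: "fst e \<in> pverts H" "snd e \<in> pverts H" if "e \<in> parcs H" for e
    using that H.arc_fst_in_verts H.arc_snd_in_verts by auto
  obtain S where S: "card (parcs H) \<le> 2 * card {e \<in> parcs H. (fst e \<in> S) \<noteq> (snd e \<in> S)}"
    using max_cut [of "pverts H" "parcs H"] H.pair_finite_verts H.pair_finite_arcs in_H
      H.pair_no_loops by (fastforce simp: mem_Times_iff)
  define D where "D = {e \<in> parcs H. fst e \<in> S \<and> snd e \<notin> S}"
  have finD: "finite D"
    unfolding D_def using H.pair_finite_arcs by simp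
  have "{e \<in> parcs H. (fst e \<in> S) \<noteq> (snd e \<in> S)} \<subseteq> D \<union> prod.swap ` D"
    using H.pair_sym_arcs by (force simp: D_def symmetric_def dest: symD)
  then have "card {e \<in> parcs H. (fst e \<in> S) \<noteq> (snd e \<in> S)} \<le> card (D \<union> prod.swap ` D)"
    using finD by (intro card_mono) auto
  also have "\<dots> \<le> card D + card (prod.swap ` D)"
    by (rule card_Un_le)
  also have "\<dots> \<le> 2 * card D"
    using card_image_le [OF finD, of prod.swap] by simp
  finally have cut: "card (parcs H) \<le> 4 * card D"
    using S by simp
  obtain g where g: "\<And>e. e \<in> parcs H \<Longrightarrow> fst (g e) \<in> fst e \<and> snd (g e) \<in> snd e \<and> g e \<in> parcs G"
  proof -
    have "\<exists>a. fst a \<in> fst e \<and> snd a \<in> snd e \<and> a \<in> parcs G" if "e \<in> parcs H" for e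
      using bspec [OF arc that] by fastforce
    then show thesis
      using that by metis
  qed
  have root_g: "anc (fst (g e)) 0 = c (fst e)" "anc (snd (g e)) 0 = c (snd e)" if "e \<in> D" for e
    using g [of e] in_H [of e] root that by (simp_all add: D_def)
  have c_inj: "A = B" if "A \<in> pverts H" "B \<in> pverts H" "c A = c B" for A B
    using disj [rule_format, OF that(1,2)] c(1) [OF that(1)] c(1) [OF that(2)] that(3) by auto
  have inj: "e = e'" if "e \<in> D" "e' \<in> D" "c (fst e) = c (fst e')" "c (snd e) = c (snd e')" for e e'
    using that c_inj in_H by (auto simp: D_def prod_eq_iff)
  have "inj_on g D"
    using inj root_g by (intro inj_onI) metis
  then have "card D = card (g ` D)"
    by (simp add: card_image)
  also have "\<dots> \<le> (\<Sum>i\<le>Suc d. C ^ i)\<^sup>2 * (2 ^ (Suc d * Suc d) * card (pverts H))"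
  proof (rule links_bound [OF G f T(1)])
    show "\<Union> (pverts H) \<subseteq> pverts G" by fact
    show "finite (g ` D)"
      using finD by simp
    show "g ` D \<subseteq> parcs G"
      using g by (auto simp: D_def)
    show "g ` D \<subseteq> \<Union> (pverts H) \<times> \<Union> (pverts H)"
    proof (intro image_subsetI)
      fix e assume "e \<in> D"
      then have e: "e \<in> parcs H"
        by (simp add: D_def)
      show "g e \<in> \<Union> (pverts H) \<times> \<Union> (pverts H)"
        unfolding mem_Times_iff using g [OF e] in_H [OF e] by blast
    qed
    show "dep v \<le> d" if "v \<in> \<Union> (pverts H)" for v
      using dep that by blast
    show "card (f ` pverts G) \<le> C" by fact
    show "anc (fst a) 0 \<noteq> anc (snd a') 0" if "a \<in> g ` D" "a' \<in> g ` D" for a a'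
    proof -
      from that obtain e e' where e: "e \<in> D" "a = g e" "e' \<in> D" "a' = g e'"
        by (elim imageE)
      have "fst e \<noteq> snd e'"
        using e by (auto simp: D_def)
      then have "c (fst e) \<noteq> c (snd e')"
        using c_inj [of "fst e" "snd e'"] in_H e by (auto simp: D_def)
      then show ?thesis
        using e root_g by simp
    qed
    show "inj_on (\<lambda>a. (anc (fst a) 0, anc (snd a) 0)) (g ` D)"
    proof (rule inj_on_imageI, rule inj_onI)
      show "e = e'" if "e \<in> D" "e' \<in> D" "((\<lambda>a. (anc (fst a) 0, anc (snd a) 0)) \<circ> g) e
          = ((\<lambda>a. (anc (fst a) 0, anc (snd a) 0)) \<circ> g) e'" for e e'
        using that inj [of e e'] root_g by simp
    qed
    have sub: "c ` fst ` D \<subseteq> c ` pverts H" "c ` snd ` D \<subseteq> c ` pverts H"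
      unfolding image_image using in_H by (intro image_subsetI imageI; simp add: D_def)+
    have "card (c ` fst ` D) \<le> card (pverts H)" "card (c ` snd ` D) \<le> card (pverts H)"
      using sub [THEN surj_card_le [OF H.pair_finite_verts]] .
    moreover have "(\<lambda>a. anc (fst a) 0) ` g ` D = c ` fst ` D"
      "(\<lambda>a. anc (snd a) 0) ` g ` D = c ` snd ` D"
      using root_g by (simp_all add: image_image)
    ultimately show "card ((\<lambda>a. anc (fst a) 0) ` g ` D) \<le> card (pverts H)"
      "card ((\<lambda>a. anc (snd a) 0) ` g ` D) \<le> card (pverts H)"
      by simp_all
  qed
  finally have "4 * card D \<le> 4 * ((\<Sum>i\<le>Suc d. C ^ i)\<^sup>2 * (2 ^ (Suc d * Suc d) * card (pverts H)))"
    by (rule mult_le_mono2)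
  moreover have "num_edges H \<le> card (parcs H)"
    unfolding num_edges_def by (rule card_image_le [OF H.pair_finite_arcs])
  then have "num_edges H \<le> 4 * card D"
    using cut by (rule le_trans)
  ultimately show ?thesis
    by (meson le_trans)
qed

section \<open>The class has bounded expansion\<close>

text \<open>
  The minimum is over a nonempty set, since a colouring with distinct colours on all vertices is
  non-repetitive.
\<close>

lemma nonrep_number_attained:
  assumes "pair_graph G"
  obtains f :: "'a \<Rightarrow> nat" where "nonrepetitive G f" "card (f ` pverts G) = nonrep_number G"
proof -
  interpret pair_graph G by fact
  obtain g :: "'a \<Rightarrow> nat" where g: "inj_on g (pverts G)"
    using finite_imp_inj_to_nat_seg [OF pair_finite_verts] by blast
  have "nonrepetitive G g"
    unfolding nonrepetitive_def
  proof (intro allI impI notI)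
    fix p assume p: "vpath p (with_proj G)" and "repetitive_on g p"
    then obtain s where s: "s \<ge> 1" "length p = 2 * s" "g (p ! 0) = g (p ! s)"
      unfolding repetitive_on_def by force
    have "p ! 0 \<in> pverts G" "p ! s \<in> pverts G"
      using p s by (auto simp: vpath_def vwalk_def subset_iff)
    then have "p ! 0 = p ! s"
      using g s(3) by (auto simp: inj_on_def)
    then show False
      using p s by (auto simp: vpath_def nth_eq_iff_index_eq)
  qed
  then have "\<exists>k. \<exists>f :: 'a \<Rightarrow> nat. nonrepetitive G f \<and> card (f ` pverts G) = k"
    by blast
  from LeastI_ex [OF this] that show thesis
    unfolding nonrep_number_def by blast
qed

theorem theorem9p11:
  fixes c :: real
  shows "bounded_expansion {G :: 'a pair_pre_digraph. pair_graph G \<and> real (nonrep_number G) \<le> c}"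
  unfolding bounded_expansion_def
proof (intro exI allI)
  fix d
  let ?b = "\<lambda>d. 4 * ((\<Sum>i\<le>Suc d. nat \<lfloor>c\<rfloor> ^ i)\<^sup>2 * 2 ^ (Suc d * Suc d))"
  show "nabla d {G :: 'a pair_pre_digraph. pair_graph G \<and> real (nonrep_number G) \<le> c}
      \<le> ereal ((\<lambda>d. real (?b d)) d)"
    unfolding nabla_def
  proof (rule SUP_least)
    fix H :: "'a set pair_pre_digraph"
    assume "H \<in> {H. pverts H \<noteq> {} \<and> (\<exists>G\<in>{G. pair_graph G \<and> real (nonrep_number G) \<le> c}.
      shallow_minor d H G)}"
    then obtain G where G: "pair_graph G" "real (nonrep_number G) \<le> c"
      and H: "pverts H \<noteq> {}" "shallow_minor d H G"
      by blast
    have pgH: "pair_graph H"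
      using H(2) by (auto simp: shallow_minor_def)
    obtain f :: "'a \<Rightarrow> nat" where f: "nonrepetitive G f" "card (f ` pverts G) = nonrep_number G"
      using nonrep_number_attained [OF G(1)] .
    have "card (f ` pverts G) \<le> nat \<lfloor>c\<rfloor>"
      using f(2) G(2) by (simp add: le_nat_floor)
    from shallow_minor_num_edges_bound [OF G(1) f(1) this pgH H(2)]
    have "num_edges H \<le> ?b d * card (pverts H)"
      by (simp only: mult.assoc)
    then have "real (num_edges H) \<le> real (?b d) * real (card (pverts H))"
      by (metis of_nat_le_iff of_nat_mult)
    moreover have "0 < card (pverts H)"
      using H(1) pgH pair_fin_digraph.pair_finite_verts [of H]
      by (auto simp: card_gt_0_iff pair_graph_def pair_digraph_def)
    ultimately have "real (num_edges H) / real (card (pverts H)) \<le> real (?b d)"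
      by (simp only: pos_divide_le_eq of_nat_0_less_iff)
    then show "ereal (real (num_edges H) / real (card (pverts H))) \<le> ereal (real (?b d))"
      by (simp only: ereal_less_eq)
  qed
qed

end
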